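(* Let $\sigma\in(0,1)$ and let $p\in P$. Let $K_1=-R^{-1}B^{T}S$ be the optimal gain for the nominal system $\dot x=A(p_0)x+Bu_1$, $u_1=K_1x$, minimizing the cost $$J_m=\int_0^\infty\left(x^{T}F_mx+x^{T}Qx+u_1^{T}Ru_1\right)dt,$$ where $S=S^T>0$ solves $$SA(p_0)+A(p_0)^{T}S+F_m+Q-SBR^{-1}B^{T}S=0 .$$ Put $$Q_1=(F_m-\phi(p)^{T}R\phi(p))+Q+(K_1+\phi(p))^{T}R(K_1+\phi(p)),\qquad \mu_1=\frac{\sigma\lambda_{\min}(Q_1)}{2\|SBK_1\|}.$$ Then the matched uncertain event-triggered system $$\dot x=A(p_0)x+BK_1x+B(\phi(p)x+K_1e),$$ that is, $\dot x(t)=A(p)x(t)+Bu_1(t_k)$ with the event-based controller $u_1(t_k)=K_1x(t_k)$ held on $[t_k,t_{k+1})$, is input-to-state stable (ISS) with respect to the measurement error $e$ if the event instants $\{t_k\}$ are given by $$t_0=0,\qquad t_{k+1}=\inf\{t\in\mathbb R : t>t_k\ \wedge\ \mu_1\|x(t)\|-\|e(t)\|\le 0\}.$$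
   Context: Matched uncertain system: $\dot x=A(p)x+Bu$, $x\in\mathbb R^n$, $u\in\mathbb R^m$, where $p\in P$ is an uncertain parameter vector, $p_0$ is the known nominal parameter, and there is a bounded uncertain matrix $\phi(p)\in\mathbb R^{m\times n}$ with $A(p)-A(p_0)=B\phi(p)$ for all $p\in P$. The weights $Q$ and $R$ are symmetric positive definite, and $F_m\ge 0$ is a symmetric matrix with $\phi(p)^{T}R\phi(p)\le F_m$ for all $p\in P$. It is assumed that $SBK_1\ne0$, so that $\mu_1$ is defined. Measurement error: $e(t)=x(t_k)-x(t)$ for $t\in[t_k,t_{k+1})$, $k\in\{0,1,2,\dots\}$. Here $\|\cdot\|$ is the Euclidean norm (induced norm for matrices), and $\lambda_{\min}$ is the smallest eigenvalue of a symmetric matrix. ISS: a system with state $x$ and input $d$ is called ISS with respect to $d$ if it has an ISS Lyapunov function, i.e. a function $V:\mathbb R^n\to\mathbb R$ for which there exist class $K_\infty$ functions $\alpha_1,\alpha_2,\alpha_3,\gamma$ such that for all $x,d\in\mathbb R^n$: $\alpha_1(\|x\|)\le V(x)\le\alpha_2(\|x\|)$ and $\nabla V(x)\dot x\le-\alpha_3(\|x\|)+\gamma(\|d\|)$. In the present setting $d$ is the measurement error $e$. A function $f:\mathbb R_{\ge0}\to\mathbb R_{\ge0}$ is class $K_\infty$ if it is continuous, strictly increasing, $f(0)=0$ and $f(s)\to\infty$ as $s\to\infty$. *)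

theory Defs
  imports "HOL-Analysis.Analysis"
begin

text \<open>Definiteness is reserved for symmetric matrices, so the Loewner order
  \<open>M \<le> N\<close> between symmetric matrices is \<open>pos_semidef (N - M)\<close>.\<close>

definition pos_def :: "real ^ 'n ^ 'n \<Rightarrow> bool" where
  "pos_def M \<longleftrightarrow> transpose M = M \<and> (\<forall>x. x \<noteq> 0 \<longrightarrow> 0 < x \<bullet> (M *v x))"

definition pos_semidef :: "real ^ 'n ^ 'n \<Rightarrow> bool" where
  "pos_semidef M \<longleftrightarrow> transpose M = M \<and> (\<forall>x. 0 \<le> x \<bullet> (M *v x))"

definition is_eigenvalue :: "real ^ 'n ^ 'n \<Rightarrow> real \<Rightarrow> bool" where
  "is_eigenvalue M l \<longleftrightarrow> (\<exists>v. v \<noteq> 0 \<and> M *v v = l *\<^sub>R v)"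

text \<open>Meaningful for symmetric matrices only: these have a nonempty finite set of real
  eigenvalues, so the least one exists.\<close>

definition lambda_min :: "real ^ 'n ^ 'n \<Rightarrow> real" where
  "lambda_min M = (LEAST l. is_eigenvalue M l)"

definition induced_norm :: "real ^ 'n ^ 'm \<Rightarrow> real" where
  "induced_norm M = onorm ((*v) M)"


text \<open>Linear-quadratic regulation. Controls are open loop and Borel measurable on the half line;
  the state equation may fail at finitely many times in each bounded interval, which covers
  piecewise continuous controls. The cost may be infinite.\<close>

definition controlled_trajectory ::
  "real ^ 'n ^ 'n \<Rightarrow> real ^ 'm ^ 'n \<Rightarrow> (real \<Rightarrow> real ^ 'n) \<Rightarrow> (real \<Rightarrow> real ^ 'm) \<Rightarrow> bool" where
  "controlled_trajectory A B x u \<longleftrightarrow>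
     continuous_on {0..} x \<and>
     u \<in> borel_measurable (restrict_space borel {0..}) \<and>
     (\<exists>N. (\<forall>T. finite (N \<inter> {0..T})) \<and>
          (\<forall>t. 0 < t \<longrightarrow> t \<notin> N \<longrightarrow>
             (x has_vector_derivative (A *v x t + B *v u t)) (at t)))"

definition quadratic_cost ::
  "real ^ 'n ^ 'n \<Rightarrow> real ^ 'm ^ 'm \<Rightarrow> (real \<Rightarrow> real ^ 'n) \<Rightarrow> (real \<Rightarrow> real ^ 'm) \<Rightarrow> ennreal" where
  "quadratic_cost W R x u =
     (\<integral>\<^sup>+t\<in>{0..}. ennreal (x t \<bullet> (W *v x t) + u t \<bullet> (R *v u t)) \<partial>lborel)"

definition optimal_gain ::
  "real ^ 'n ^ 'n \<Rightarrow> real ^ 'm ^ 'n \<Rightarrow> real ^ 'n ^ 'n \<Rightarrow> real ^ 'm ^ 'm \<Rightarrow> real ^ 'n ^ 'm \<Rightarrow> bool" where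
  "optimal_gain A B W R K \<longleftrightarrow>
     (\<forall>x x' u'.
        controlled_trajectory A B x (\<lambda>t. K *v x t) \<longrightarrow>
        controlled_trajectory A B x' u' \<longrightarrow> x' 0 = x 0 \<longrightarrow>
        quadratic_cost W R x (\<lambda>t. K *v x t) \<le> quadratic_cost W R x' u')"

lemma pos_def_sym: "pos_def M \<Longrightarrow> (M *v x) \<bullet> y = x \<bullet> (M *v y)"
  unfolding pos_def_def by (metis dot_lmul_matrix transpose_matrix_vector)

lemma pos_def_lower:
  fixes M :: "real ^ 'n ^ 'n"
  assumes "pos_def M"
  obtains c where "0 < c" "\<And>x. c * (norm x)\<^sup>2 \<le> x \<bullet> (M *v x)"
proof -
  have "continuous_on (sphere 0 1) (\<lambda>x. x \<bullet> (M *v x))"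
    by (intro continuous_intros linear_continuous_on matrix_vector_mul_bounded_linear)
  then have "\<exists>z\<in>sphere 0 1. \<forall>y\<in>sphere 0 1. z \<bullet> (M *v z) \<le> y \<bullet> (M *v y)"
    by (intro continuous_attains_inf) auto
  then obtain z where z: "z \<in> sphere 0 1"
    and le: "\<And>y. y \<in> sphere 0 1 \<Longrightarrow> z \<bullet> (M *v z) \<le> y \<bullet> (M *v y)"
    by blast
  define c where "c = z \<bullet> (M *v z)"
  have "z \<noteq> 0" using z by auto
  then have "0 < c" using assms by (simp add: c_def pos_def_def)
  moreover have "c * (norm x)\<^sup>2 \<le> x \<bullet> (M *v x)" for x
  proof (cases "x = 0")
    case False
    let ?y = "(1 / norm x) *\<^sub>R x"
    have "c \<le> ?y \<bullet> (M *v ?y)" using False unfolding c_def by (intro le) auto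
    also have "\<dots> = (x \<bullet> (M *v x)) / (norm x)\<^sup>2"
      by (simp add: matrix_vector_mult_scaleR power2_eq_square)
    finally show ?thesis using False by (simp add: field_simps)
  qed simp
  ultimately show thesis by (rule that)
qed

lemma pos_def_inv:
  assumes "pos_def R" shows "R *v (matrix_inv R *v y) = y"
proof -
  have "inj ((*v) R)"
  proof (rule injI)
    fix a b assume "R *v a = R *v b"
    then have "(a - b) \<bullet> (R *v (a - b)) = 0" by (simp add: matrix_vector_mult_diff_distrib)
    with assms show "a = b" unfolding pos_def_def by (metis eq_iff_diff_eq_0 less_irrefl)
  qed
  then have "\<exists>X. X ** R = mat 1" by (simp add: matrix_left_invertible_injective)
  then have "invertible R" by (metis invertible_left_inverse)
  then have "R ** matrix_inv R = mat 1"
    unfolding invertible_def matrix_inv_def by (metis (mono_tags, lifting) someI_ex)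
  then show ?thesis by (simp add: matrix_vector_mul_assoc)
qed

lemma riccati_completion_of_squares:
  assumes S: "pos_def S" and R: "pos_def R"
    and riccati: "S ** A + transpose A ** S + W - S ** B ** matrix_inv R ** transpose B ** S = 0"
    and K: "K = - (matrix_inv R ** transpose B ** S)"
  shows "2 * ((S *v x) \<bullet> (A *v x + B *v u)) =
     (u - K *v x) \<bullet> (R *v (u - K *v x)) - (x \<bullet> (W *v x) + u \<bullet> (R *v u))"
proof -
  define b where "b = transpose B *v (S *v x)"
  define k where "k = K *v x"
  have kb: "k = - (matrix_inv R *v b)"
    unfolding k_def K b_def by (simp add: matrix_vector_mul_assoc matrix_mul_assoc)
      (simp add: vec_eq_iff matrix_vector_mult_def sum_negf)
  have Rk: "R *v k = - b"
    unfolding kb using pos_def_inv[OF R, of b] by (metis mult_minus1 matrix_vector_mult_scaleR scaleR_minus1_left)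
  have SB: "(S *v x) \<bullet> (B *v v) = b \<bullet> v" for v
    unfolding b_def by (metis dot_lmul_matrix transpose_matrix_vector)
  have "0 = x \<bullet> ((S ** A + transpose A ** S + W - S ** B ** matrix_inv R ** transpose B ** S) *v x)"
    by (simp add: riccati)
  also have "\<dots> = x \<bullet> (S *v (A *v x)) + x \<bullet> (transpose A *v (S *v x)) + x \<bullet> (W *v x)
       - x \<bullet> (S *v (B *v (matrix_inv R *v b)))"
    unfolding b_def
    by (simp add: matrix_vector_mult_add_rdistrib matrix_vector_mult_diff_rdistrib inner_add_right
        inner_diff_right matrix_vector_mul_assoc matrix_mul_assoc)
  also have "x \<bullet> (transpose A *v (S *v x)) = (S *v x) \<bullet> (A *v x)"
    by (metis dot_lmul_matrix transpose_matrix_vector inner_commute)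
  also have "x \<bullet> (S *v (A *v x)) = (S *v x) \<bullet> (A *v x)" by (simp add: pos_def_sym[OF S])
  also have "x \<bullet> (S *v (B *v (matrix_inv R *v b))) = b \<bullet> (matrix_inv R *v b)"
    by (metis pos_def_sym[OF S] SB)
  also have "\<dots> = - (b \<bullet> k)" by (simp add: kb)
  finally have e: "2 * ((S *v x) \<bullet> (A *v x)) = - (x \<bullet> (W *v x)) - b \<bullet> k" by simp
  have "u \<bullet> (R *v k) = k \<bullet> (R *v u)" by (metis pos_def_sym[OF R] inner_commute)
  then have kRu: "k \<bullet> (R *v u) = - (b \<bullet> u)" by (simp add: Rk inner_commute)
  have "(u - k) \<bullet> (R *v (u - k)) = u \<bullet> (R *v u) - u \<bullet> (R *v k) - k \<bullet> (R *v u) + k \<bullet> (R *v k)"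
    by (simp add: matrix_vector_mult_diff_distrib inner_diff_left inner_diff_right)
  also have "\<dots> = u \<bullet> (R *v u) + 2 * (b \<bullet> u) - b \<bullet> k"
    by (simp add: Rk kRu inner_commute)
  finally show ?thesis using e SB[of u] unfolding k_def by (simp add: inner_add_right)
qed

lemma nonneg_has_integral_of_nn_integral:
  fixes g :: "real \<Rightarrow> real"
  assumes "\<And>t. 0 \<le> g t" "(\<lambda>t. indicator {0..T} t * g t) \<in> borel_measurable borel"
    and "(\<integral>\<^sup>+t\<in>{0..T}. ennreal (g t) \<partial>lborel) < \<infinity>"
  shows "(g has_integral enn2real (\<integral>\<^sup>+t\<in>{0..T}. ennreal (g t) \<partial>lborel)) {0..T}"
proof -
  have e: "(\<integral>\<^sup>+t. ennreal (indicator {0..T} t * g t) \<partial>lborel) = (\<integral>\<^sup>+t\<in>{0..T}. ennreal (g t) \<partial>lborel)"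
    by (intro nn_integral_cong) (auto split: split_indicator)
  have "((\<lambda>t. indicator {0..T} t * g t) has_integral enn2real (\<integral>\<^sup>+t\<in>{0..T}. ennreal (g t) \<partial>lborel)) UNIV"
    using assms by (intro nn_integral_has_integral) (auto simp: e)
  moreover have "(\<lambda>t. indicator {0..T} t * g t) = (\<lambda>t. if t \<in> {0..T} then g t else 0)"
    by (auto simp: fun_eq_iff)
  ultimately show ?thesis by (simp only: has_integral_restrict_UNIV)
qed

text \<open>Optimality of the gain as defined above is a consequence of the Riccati equation; a
  hypothesis \<open>optimal_gain\<close> next to that equation excludes nothing.\<close>

theorem riccati_gain_optimal:
  fixes A W S :: "real ^ 'n ^ 'n" and B :: "real ^ 'm ^ 'n"
  assumes W: "pos_def W" and R: "pos_def R" and S: "pos_def S"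
    and riccati: "S ** A + transpose A ** S + W - S ** B ** matrix_inv R ** transpose B ** S = 0"
    and K: "K = - (matrix_inv R ** transpose B ** S)"
  shows "optimal_gain A B W R K"
proof -
  define V where "V y = y \<bullet> (S *v y)" for y
  define g where "g y v = y \<bullet> (W *v y) + v \<bullet> (R *v v)" for y v
  define w where "w y v = (v - K *v y) \<bullet> (R *v (v - K *v y))" for y v
  have nn: "0 \<le> (M *v y) \<bullet> y" if "pos_def M" for M :: "real^'a^'a" and y
    using that unfolding pos_def_def by (cases "y = 0") (auto simp: inner_commute less_imp_le)
  have g0: "0 \<le> g y v" and w0: "0 \<le> w y v" and V0: "0 \<le> V y" for y v
    using nn[OF W] nn[OF R] nn[OF S] unfolding g_def w_def V_def by (auto simp: inner_commute)
  have contV: "continuous_on X (\<lambda>t. V (x t))" if "continuous_on X x" for X and x :: "real \<Rightarrow> real^'n"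
    unfolding V_def
    by (intro continuous_intros that bounded_linear.continuous_on[OF matrix_vector_mul_bounded_linear])
  have FTC: "((\<lambda>t. w (x t) (u t) - g (x t) (u t)) has_integral V (x T) - V (x 0)) {0..T}"
    if tr: "controlled_trajectory A B x u" and T: "0 \<le> T" for x u T
  proof -
    obtain N where N: "\<And>T. finite (N \<inter> {0..T})"
      and d: "\<And>t. 0 < t \<Longrightarrow> t \<notin> N \<Longrightarrow> (x has_vector_derivative (A *v x t + B *v u t)) (at t)"
      and c: "continuous_on {0..} x"
      using tr unfolding controlled_trajectory_def by blast
    show ?thesis
    proof (rule fundamental_theorem_of_calculus_interior_strong[OF N[of T] T])
      fix t assume t: "t \<in> {0<..<T} - (N \<inter> {0..T})"
      then have x': "(x has_vector_derivative (A *v x t + B *v u t)) (at t)" by (intro d) auto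
      then have "(x has_derivative (\<lambda>h. h *\<^sub>R (A *v x t + B *v u t))) (at t)"
        by (simp add: has_vector_derivative_def)
      then have "((\<lambda>t. V (x t)) has_derivative
          (\<lambda>h. x t \<bullet> (S *v (h *\<^sub>R (A *v x t + B *v u t))) + h *\<^sub>R (A *v x t + B *v u t) \<bullet> (S *v x t))) (at t)"
        unfolding V_def
        by (intro has_derivative_inner bounded_linear.has_derivative[OF matrix_vector_mul_bounded_linear])
      moreover have "(\<lambda>h. x t \<bullet> (S *v (h *\<^sub>R (A *v x t + B *v u t))) + h *\<^sub>R (A *v x t + B *v u t) \<bullet> (S *v x t))
          = (\<lambda>h. h *\<^sub>R (w (x t) (u t) - g (x t) (u t)))"
      proof
        fix h
        let ?y = "A *v x t + B *v u t"
        have "x t \<bullet> (S *v (h *\<^sub>R ?y)) + h *\<^sub>R ?y \<bullet> (S *v x t) = h * (2 * ((S *v x t) \<bullet> ?y))"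
          using pos_def_sym[OF S, of "x t" ?y] inner_commute[of ?y "S *v x t"]
          by (simp only: matrix_vector_mult_scaleR inner_scaleR_left inner_scaleR_right)
        then show "x t \<bullet> (S *v (h *\<^sub>R ?y)) + h *\<^sub>R ?y \<bullet> (S *v x t) = h *\<^sub>R (w (x t) (u t) - g (x t) (u t))"
          unfolding w_def g_def riccati_completion_of_squares[OF S R riccati K] by simp
      qed
      ultimately show "((\<lambda>t. V (x t)) has_vector_derivative (w (x t) (u t) - g (x t) (u t))) (at t)"
        by (simp add: has_vector_derivative_def)
    qed (use c in \<open>auto intro!: contV intro: continuous_on_subset\<close>)
  qed
  have cost: "quadratic_cost W R x u = (\<integral>\<^sup>+t\<in>{0..}. ennreal (g (x t) (u t)) \<partial>lborel)" for x u
    unfolding quadratic_cost_def g_def ..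
  have upper: "quadratic_cost W R x (\<lambda>t. K *v x t) \<le> ennreal (V (x 0))"
    if tr: "controlled_trajectory A B x (\<lambda>t. K *v x t)" for x
  proof -
    let ?g = "\<lambda>t. g (x t) (K *v x t)"
    have c: "continuous_on {0..} x" using tr by (simp add: controlled_trajectory_def)
    have cg: "continuous_on {0..} ?g"
      unfolding g_def
      by (intro continuous_intros c bounded_linear.continuous_on[OF matrix_vector_mul_bounded_linear])
    have m: "(\<lambda>t. ennreal (?g t) * indicator {0..real n} t) \<in> borel_measurable lborel" for n :: nat
    proof -
      have "(\<lambda>t. indicator {0..real n} t *\<^sub>R ?g t) \<in> borel_measurable borel"
        by (rule borel_measurable_continuous_on_indicator) (auto intro: continuous_on_subset[OF cg])
      then have "(\<lambda>t. ennreal (indicator {0..real n} t *\<^sub>R ?g t)) \<in> borel_measurable lborel" by simp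
      also have "(\<lambda>t. ennreal (indicator {0..real n} t *\<^sub>R ?g t)) = (\<lambda>t. ennreal (?g t) * indicator {0..real n} t)"
        by (auto simp: fun_eq_iff split: split_indicator)
      finally show ?thesis .
    qed
    have sup: "ennreal (?g t) * indicator {0..} t = (SUP n. ennreal (?g t) * indicator {0..real n} t)" for t
    proof (rule antisym)
      obtain n where "t \<le> real n" using real_arch_simple by blast
      then have "ennreal (?g t) * indicator {0..} t = ennreal (?g t) * indicator {0..real n} t"
        by (auto split: split_indicator)
      then show "ennreal (?g t) * indicator {0..} t \<le> (SUP n. ennreal (?g t) * indicator {0..real n} t)"
        by (simp only:) (rule SUP_upper, simp)
    qed (auto intro!: SUP_least split: split_indicator)
    have "quadratic_cost W R x (\<lambda>t. K *v x t) = (SUP n. \<integral>\<^sup>+t\<in>{0..real n}. ennreal (?g t) \<partial>lborel)"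
      unfolding cost sup
      by (rule nn_integral_monotone_convergence_SUP)
        (use m in \<open>auto simp: incseq_def le_fun_def split: split_indicator\<close>)
    also have "\<dots> \<le> ennreal (V (x 0))"
    proof (rule SUP_least)
      fix n :: nat
      have "w y (K *v y) = 0" for y by (simp add: w_def)
      then have "(?g has_integral V (x 0) - V (x n)) {0..real n}"
        using has_integral_neg[OF FTC[OF tr, of "real n"]] by simp
      from nn_integral_has_integral_lebesgue'[OF _ this]
      show "(\<integral>\<^sup>+t\<in>{0..real n}. ennreal (?g t) \<partial>lborel) \<le> ennreal (V (x 0))"
        using g0 V0 by (simp add: ennreal_leI)
    qed
    finally show ?thesis .
  qed
  have lower: "ennreal (V (x 0)) \<le> quadratic_cost W R x u" if tr: "controlled_trajectory A B x u" for x u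
  proof (rule ccontr)
    let ?g = "\<lambda>t. g (x t) (u t)"
    let ?J = "quadratic_cost W R x u"
    assume "\<not> ennreal (V (x 0)) \<le> ?J"
    then have lt: "?J < ennreal (V (x 0))" by simp
    then have fin: "?J < \<infinity>" by (metis ennreal_less_top infinity_ennreal_def less_trans)
    define J where "J = enn2real ?J"
    have J: "?J = ennreal J" "0 \<le> J" using fin by (auto simp: J_def)
    have JV: "J < V (x 0)" using lt J by (simp add: ennreal_less_iff)
    have c: "continuous_on {0..} x" and u: "u \<in> borel_measurable (restrict_space borel {0..})"
      using tr by (auto simp: controlled_trajectory_def)
    have xm: "x \<in> borel_measurable (restrict_space borel {0..})"
      using c by (rule borel_measurable_continuous_on_restrict)
    have mv: "(\<lambda>t. M *v y t) \<in> borel_measurable X" if "y \<in> borel_measurable X" for M :: "real^'a^'b" and y and X :: "real measure"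
      using measurable_compose[OF that, of "(*v) M" borel]
      by (simp add: borel_measurable_continuous_onI linear_continuous_on matrix_vector_mul_bounded_linear)
    have gm: "?g \<in> borel_measurable (restrict_space borel {0..})"
      unfolding g_def by (intro borel_measurable_add borel_measurable_inner mv xm u)
    have gT: "(\<lambda>t. indicator {0..T} t * ?g t) \<in> borel_measurable borel" for T
    proof -
      have "(\<lambda>t. ?g t * indicator {0..} t) \<in> borel_measurable borel"
        using gm by (simp add: borel_measurable_restrict_space_iff mult.commute)
      then have "(\<lambda>t. indicator {0..T} t * (?g t * indicator {0..} t)) \<in> borel_measurable borel" by measurable
      also have "(\<lambda>t. indicator {0..T} t * (?g t * indicator {0..} t)) = (\<lambda>t. indicator {0..T} t * ?g t)"
        by (auto simp: fun_eq_iff split: split_indicator)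
      finally show ?thesis .
    qed
    have intle: "(\<integral>\<^sup>+t\<in>{0..T}. ennreal (?g t) \<partial>lborel) \<le> ?J" for T
      unfolding cost by (intro nn_integral_mono) (auto split: split_indicator)
    have VT: "V (x 0) - J \<le> V (x T)" if T: "0 \<le> T" for T
    proof -
      let ?I = "\<integral>\<^sup>+t\<in>{0..T}. ennreal (?g t) \<partial>lborel"
      have "(?g has_integral enn2real ?I) {0..T}"
        using intle[of T] fin by (intro nonneg_has_integral_of_nn_integral g0 gT) (auto intro: le_less_trans)
      from has_integral_add[OF FTC[OF tr T] this]
      have "((\<lambda>t. w (x t) (u t)) has_integral V (x T) - V (x 0) + enn2real ?I) {0..T}" by simp
      then have "0 \<le> V (x T) - V (x 0) + enn2real ?I" by (rule has_integral_nonneg) (rule w0)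
      moreover have "enn2real ?I \<le> J" unfolding J_def by (intro enn2real_mono intle) (use fin in auto)
      ultimately show ?thesis by simp
    qed
    obtain c1 where c1: "0 < c1" "\<And>y. c1 * (norm y)\<^sup>2 \<le> y \<bullet> (W *v y)" using pos_def_lower[OF W] by blast
    obtain c2 where c2: "0 < c2" "\<And>y. norm (S *v y) \<le> norm y * c2"
      using bounded_linear.pos_bounded[OF matrix_vector_mul_bounded_linear[of S]] by blast
    have Vg: "c1 / c2 * V y \<le> g y v" for y v
    proof -
      have "V y \<le> norm y * norm (S *v y)" unfolding V_def by (rule norm_cauchy_schwarz)
      also have "\<dots> \<le> norm y * (norm y * c2)" by (intro mult_left_mono c2) auto
      finally have "c1 * V y \<le> c1 * (c2 * (norm y)\<^sup>2)" using c1(1) by (simp add: power2_eq_square mult_ac)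
      also have "\<dots> \<le> c2 * (y \<bullet> (W *v y))" using c1(2)[of y] c2(1) by (simp add: mult.left_commute)
      also have "\<dots> \<le> c2 * g y v" using nn[OF R, of v] c2(1) by (simp add: g_def inner_commute)
      finally show ?thesis using c2(1) by (simp add: field_simps)
    qed
    define \<delta> where "\<delta> = c1 / c2 * (V (x 0) - J)"
    have \<delta>: "0 < \<delta>" using c1 c2 JV by (simp add: \<delta>_def)
    have lb: "\<delta> \<le> ?g t" if "0 \<le> t" for t
    proof -
      have "\<delta> \<le> c1 / c2 * V (x t)" unfolding \<delta>_def using VT[OF that] c1 c2 by (intro mult_left_mono) auto
      then show ?thesis using Vg[of "x t" "u t"] by linarith
    qed
    have "(\<integral>\<^sup>+t\<in>{0::real..}. ennreal \<delta> \<partial>lborel) \<le> ?J"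
      unfolding cost by (intro nn_integral_mono) (auto split: split_indicator intro: ennreal_leI lb)
    moreover have "(\<integral>\<^sup>+t\<in>{0::real..}. ennreal \<delta> \<partial>lborel) = \<infinity>"
    proof -
      have le: "ennreal (real n) \<le> emeasure lborel {0::real..}" for n :: nat
        using emeasure_mono[of "{0..real n}" "{0..}" lborel] by simp
      have "emeasure lborel {0::real..} = top"
      proof (rule ccontr)
        assume "emeasure lborel {0::real..} \<noteq> top"
        then obtain r where r: "emeasure lborel {0::real..} = ennreal r" "0 \<le> r"
          by (cases "emeasure lborel {0::real..}") auto
        obtain n where "r < real n" using reals_Archimedean2 by blast
        then show False using le[of n] r by simp
      qed
      then show ?thesis using \<delta> by (simp add: nn_integral_cmult_indicator ennreal_mult_eq_top_iff)
    qed
    ultimately show False using fin by simp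
  qed
  show ?thesis unfolding optimal_gain_def
    using upper lower by (metis order_trans)
qed


text \<open>A class \<open>K_infinity\<close> function is only looked at on the half line; nonnegativity
  there follows from monotonicity.\<close>

definition class_K_infinity :: "(real \<Rightarrow> real) \<Rightarrow> bool" where
  "class_K_infinity f \<longleftrightarrow>
     continuous_on {0..} f \<and> strict_mono_on {0..} f \<and> f 0 = 0 \<and> filterlim f at_top at_top"

text \<open>\<open>f x d\<close> is the right-hand side of the system with state \<open>x\<close> and input \<open>d\<close>.\<close>

definition ISS_Lyapunov_function ::
  "('a::euclidean_space \<Rightarrow> 'b::real_normed_vector \<Rightarrow> 'a) \<Rightarrow> ('a \<Rightarrow> real) \<Rightarrow> bool" where
  "ISS_Lyapunov_function f V \<longleftrightarrow>
     (\<forall>x. V differentiable (at x)) \<and>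
     (\<exists>\<alpha>1 \<alpha>2 \<alpha>3 \<gamma>.
        class_K_infinity \<alpha>1 \<and> class_K_infinity \<alpha>2 \<and> class_K_infinity \<alpha>3 \<and> class_K_infinity \<gamma> \<and>
        (\<forall>x d. \<alpha>1 (norm x) \<le> V x \<and> V x \<le> \<alpha>2 (norm x) \<and>
           frechet_derivative V (at x) (f x d) \<le> - \<alpha>3 (norm x) + \<gamma> (norm d)))"

definition input_to_state_stable ::
  "('a::euclidean_space \<Rightarrow> 'b::real_normed_vector \<Rightarrow> 'a) \<Rightarrow> bool" where
  "input_to_state_stable f \<longleftrightarrow> (\<exists>V. ISS_Lyapunov_function f V)"


definition closed_loop ::
  "real ^ 'n ^ 'n \<Rightarrow> real ^ 'm ^ 'n \<Rightarrow> real ^ 'n ^ 'm \<Rightarrow> real ^ 'n ^ 'm \<Rightarrow>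
     real ^ 'n \<Rightarrow> real ^ 'n \<Rightarrow> real ^ 'n" where
  "closed_loop A0 B K \<Phi> x e = A0 *v x + (B ** K) *v x + B *v (\<Phi> *v x + K *v e)"

text \<open>Event instants are extended reals: \<open>t k = \<infinity>\<close> means that the \<open>k\<close>-th event never
  happens, and the infimum of the empty set is \<open>\<infinity>\<close>. Nothing is sampled at an infinite
  instant: the interval starting there is empty and all later instants are infinite.\<close>

definition inter_event :: "(nat \<Rightarrow> ereal) \<Rightarrow> nat \<Rightarrow> real set" where
  "inter_event t k = {s. t k \<le> ereal s \<and> ereal s < t (Suc k)}"

text \<open>The error relative to the \<open>k\<close>-th sample. The triggering rule needs it also at the
  time \<open>t (Suc k)\<close> itself, just before the error is reset.\<close>

definition measurement_error ::
  "(real \<Rightarrow> real ^ 'n) \<Rightarrow> (nat \<Rightarrow> ereal) \<Rightarrow> nat \<Rightarrow> real \<Rightarrow> real ^ 'n" where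
  "measurement_error x t k s = x (real_of_ereal (t k)) - x s"

definition event_instants :: "real \<Rightarrow> (real \<Rightarrow> real ^ 'n) \<Rightarrow> (nat \<Rightarrow> ereal) \<Rightarrow> bool" where
  "event_instants \<mu> x t \<longleftrightarrow>
     t 0 = 0 \<and>
     (\<forall>k. t (Suc k) =
        Inf {ereal s | s. ereal s > t k \<and> \<mu> * norm (x s) - norm (measurement_error x t k s) \<le> 0})"

text \<open>The derivative within the inter-event interval is one-sided at the event instants, where
  the held control jumps, and two-sided elsewhere.\<close>

definition sampled_data_solution ::
  "real ^ 'n ^ 'n \<Rightarrow> real ^ 'm ^ 'n \<Rightarrow> real ^ 'n ^ 'm \<Rightarrow>
     (real \<Rightarrow> real ^ 'n) \<Rightarrow> (nat \<Rightarrow> ereal) \<Rightarrow> bool" where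
  "sampled_data_solution A B K x t \<longleftrightarrow>
     continuous_on {0..} x \<and>
     (\<forall>k. \<forall>s \<in> inter_event t k.
        (x has_vector_derivative (A *v x s + B *v (K *v x (real_of_ereal (t k)))))
          (at s within inter_event t k))"

end

theory Submission
  imports Defs
begin

text \<open>The quadratic form \<open>V x = x \<bullet> S x\<close> is an ISS Lyapunov function. The uncertainty is matched, so
  it enters through the input channel: the perturbed loop is the nominal system driven by
  \<open>u = (K1 + \<phi>) x + K1 e\<close>. For \<open>e = 0\<close>, completing the square in the Riccati equation gives
  \<open>\<nabla>V \<cdot> f = - x \<bullet> Q1 x\<close>: the deviation \<open>\<phi> x\<close> of \<open>u\<close> from the optimal control adds the nonnegative
  term \<open>\<phi> x \<bullet> R \<phi> x\<close>, and the weight \<open>F\<close> was put into the cost precisely to absorb it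
  (lemma \<open>riccati_decay_matched\<close>). What remains is at least the decay \<open>x \<bullet> Q x\<close>, hence quadratic
  in \<open>norm x\<close>.

  The error contributes only the bilinear term \<open>2 (S x) \<bullet> (B K1 e)\<close>. Young's inequality splits it
  into half of the decay and a multiple of \<open>(norm e)\<^sup>2\<close>, which is the ISS estimate with all four
  comparison functions quadratic (lemma \<open>quadratic_ISS\<close>).

  ISS in this sense is a property of the vector field with the error as a free input. It concerns
  the event-triggered loop because the solution follows that vector field between events:
  substituting \<open>x(t\<^sub>k) = x + e\<close> in the held control turns one right-hand side into the other
  (lemma \<open>held_control_eq_closed_loop\<close>).\<close>

lemma class_K_infinity_quadratic:
  fixes c :: real
  assumes "0 < c"
  shows "class_K_infinity (\<lambda>s. c * s\<^sup>2)"
proof -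
  have "filterlim (\<lambda>s::real. s ^ 2) at_top at_top"
    by (rule filterlim_pow_at_top[OF _ filterlim_ident]) simp
  then have "filterlim (\<lambda>s. c * s\<^sup>2) at_top at_top"
    by (rule filterlim_tendsto_pos_mult_at_top[OF tendsto_const assms])
  moreover have "strict_mono_on {0..} (\<lambda>s. c * s\<^sup>2)"
    using assms by (auto intro!: strict_mono_onI power_strict_mono)
  ultimately show ?thesis
    unfolding class_K_infinity_def by (auto intro!: continuous_intros)
qed

lemma has_derivative_quadratic_form:
  fixes S :: "real ^ 'n ^ 'n"
  assumes "pos_def S"
  shows "((\<lambda>x. x \<bullet> (S *v x)) has_derivative (\<lambda>h. 2 * ((S *v x) \<bullet> h))) (at x)"
proof -
  have "((\<lambda>x. x \<bullet> (S *v x)) has_derivative (\<lambda>h. x \<bullet> (S *v h) + h \<bullet> (S *v x))) (at x)"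
    by (intro has_derivative_inner has_derivative_ident
        bounded_linear.has_derivative[OF matrix_vector_mul_bounded_linear])
  moreover have "x \<bullet> (S *v h) + h \<bullet> (S *v x) = 2 * ((S *v x) \<bullet> h)" for h
    using pos_def_sym[OF assms, of x h] by (simp add: inner_commute)
  ultimately show ?thesis by simp
qed

text \<open>The error enters the bound on the derivative only through the product \<open>norm x * norm e\<close>.
  By Young's inequality half of the decay pays for the state factor, and the rest is quadratic in
  the error alone.\<close>

lemma quadratic_ISS:
  fixes S :: "real ^ 'n ^ 'n" and f :: "real ^ 'n \<Rightarrow> 'b::real_normed_vector \<Rightarrow> real ^ 'n"
  assumes S: "pos_def S" and c: "0 < c" and b: "0 < b"
    and decay: "\<And>x e. 2 * ((S *v x) \<bullet> f x e) \<le> - c * (norm x)\<^sup>2 + b * norm x * norm e"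
  shows "ISS_Lyapunov_function f (\<lambda>x. x \<bullet> (S *v x))"
proof -
  obtain s1 where s1: "0 < s1" "\<And>x. s1 * (norm x)\<^sup>2 \<le> x \<bullet> (S *v x)"
    using pos_def_lower[OF S] by blast
  obtain s2 where s2: "0 < s2" "\<And>x. norm (S *v x) \<le> norm x * s2"
    using bounded_linear.pos_bounded[OF matrix_vector_mul_bounded_linear[of S]] by blast
  have upper: "x \<bullet> (S *v x) \<le> s2 * (norm x)\<^sup>2" for x
  proof -
    have "x \<bullet> (S *v x) \<le> norm x * norm (S *v x)" by (rule norm_cauchy_schwarz)
    also have "\<dots> \<le> norm x * (norm x * s2)" by (intro mult_left_mono s2) auto
    finally show ?thesis by (simp add: power2_eq_square mult_ac)
  qed
  have deriv: "frechet_derivative (\<lambda>x. x \<bullet> (S *v x)) (at x) = (\<lambda>h. 2 * ((S *v x) \<bullet> h))" for x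
    using has_derivative_quadratic_form[OF S] by (metis frechet_derivative_at)
  have diff: "(\<lambda>x. x \<bullet> (S *v x)) differentiable (at x)" for x
    using has_derivative_quadratic_form[OF S] unfolding differentiable_def by blast
  have young: "b * r * s \<le> c / 2 * r\<^sup>2 + b\<^sup>2 / (2 * c) * s\<^sup>2" for r s :: real
  proof -
    have "0 \<le> (c * r - b * s)\<^sup>2 / (2 * c)" using c by simp
    also have "\<dots> = c / 2 * r\<^sup>2 + b\<^sup>2 / (2 * c) * s\<^sup>2 - b * r * s"
      using c by (simp add: field_simps power2_eq_square)
    finally show ?thesis by simp
  qed
  have "2 * ((S *v x) \<bullet> f x e) \<le> - (c / 2 * (norm x)\<^sup>2) + b\<^sup>2 / (2 * c) * (norm e)\<^sup>2" for x e
    using decay[of x e] young[of "norm x" "norm e"] by (simp add: field_simps)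
  moreover have "class_K_infinity (\<lambda>s. s1 * s\<^sup>2)" "class_K_infinity (\<lambda>s. s2 * s\<^sup>2)"
    "class_K_infinity (\<lambda>s. c / 2 * s\<^sup>2)" "class_K_infinity (\<lambda>s. b\<^sup>2 / (2 * c) * s\<^sup>2)"
    using s1 s2 b c by (intro class_K_infinity_quadratic; simp)+
  ultimately show ?thesis
    unfolding ISS_Lyapunov_function_def deriv
    using s1(2) upper diff by blast
qed

lemma inner_congruence:
  fixes M :: "real ^ 'n ^ 'm" and R :: "real ^ 'm ^ 'm"
  shows "x \<bullet> ((transpose M ** R ** M) *v x) = (M *v x) \<bullet> (R *v (M *v x))"
  by (simp add: matrix_vector_mul_assoc[symmetric])
    (metis dot_lmul_matrix transpose_matrix_vector transpose_transpose)

text \<open>This is \<open>riccati_completion_of_squares\<close> with the control \<open>(K + \<Phi>) x\<close>, whose deviation from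
  the optimal one is \<open>\<Phi> x\<close>. The matrix on the right is the \<open>Q1\<close> of the theorem.\<close>

lemma riccati_decay_matched:
  fixes A F Q S :: "real ^ 'n ^ 'n" and B :: "real ^ 'm ^ 'n" and \<Phi> :: "real ^ 'n ^ 'm"
  assumes S: "pos_def S" and R: "pos_def R"
    and riccati: "S ** A + transpose A ** S + F + Q
                    - S ** B ** matrix_inv R ** transpose B ** S = 0"
    and K: "K = - (matrix_inv R ** transpose B ** S)"
  shows "2 * ((S *v x) \<bullet> (A *v x + B *v ((K + \<Phi>) *v x)))
    = - (x \<bullet> (((F - transpose \<Phi> ** R ** \<Phi>) + Q + transpose (K + \<Phi>) ** R ** (K + \<Phi>)) *v x))"
proof -
  have "S ** A + transpose A ** S + (F + Q) - S ** B ** matrix_inv R ** transpose B ** S = 0"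
    using riccati by (simp add: add.assoc)
  from riccati_completion_of_squares[OF S R this K, of x "(K + \<Phi>) *v x"]
  have "2 * ((S *v x) \<bullet> (A *v x + B *v ((K + \<Phi>) *v x)))
      = (\<Phi> *v x) \<bullet> (R *v (\<Phi> *v x)) - x \<bullet> ((F + Q) *v x)
        - ((K + \<Phi>) *v x) \<bullet> (R *v ((K + \<Phi>) *v x))"
    by (simp add: matrix_vector_mult_add_rdistrib)
  then show ?thesis
    unfolding inner_congruence[symmetric]
    by (simp only: matrix_vector_mult_add_rdistrib[of _ "transpose (K + \<Phi>) ** R ** (K + \<Phi>)"]
        matrix_vector_mult_add_rdistrib[of _ Q] matrix_vector_mult_diff_rdistrib
        inner_add_right inner_diff_right)
qed

lemma held_control_eq_closed_loop:
  assumes "A - A0 = B ** \<Phi>"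
  shows "A *v y + B *v (K *v z) = closed_loop A0 B K \<Phi> y (z - y)"
proof -
  have "A = A0 + B ** \<Phi>" using assms by (simp add: algebra_simps)
  then show ?thesis
    by (simp add: closed_loop_def matrix_vector_mult_add_rdistrib matrix_vector_mult_diff_distrib
        matrix_vector_right_distrib matrix_vector_mul_assoc)
qed

text \<open>\<open>Q\<close> alone supplies the decay: the other two parts of \<open>Q1\<close> are positive semidefinite, the first
  by the bound on the uncertainty and the second because it is a congruence of \<open>R\<close>.\<close>

lemma matched_closed_loop_ISS:
  fixes A F Q S :: "real ^ 'n ^ 'n" and B :: "real ^ 'm ^ 'n" and \<Phi> :: "real ^ 'n ^ 'm"
  assumes S: "pos_def S" and R: "pos_def R" and Q: "pos_def Q"
    and bound: "pos_semidef (F - transpose \<Phi> ** R ** \<Phi>)"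
    and riccati: "S ** A + transpose A ** S + F + Q
                    - S ** B ** matrix_inv R ** transpose B ** S = 0"
    and K: "K = - (matrix_inv R ** transpose B ** S)"
  shows "ISS_Lyapunov_function (closed_loop A B K \<Phi>) (\<lambda>x. x \<bullet> (S *v x))"
proof -
  let ?G = "F - transpose \<Phi> ** R ** \<Phi>" and ?U = "transpose (K + \<Phi>) ** R ** (K + \<Phi>)"
  obtain c where c: "0 < c" "\<And>x. c * (norm x)\<^sup>2 \<le> x \<bullet> (Q *v x)"
    using pos_def_lower[OF Q] by blast
  \<comment> \<open>A strictly positive bound instead of the operator norm: the coefficient of \<open>\<gamma>\<close> is a multiple of
    \<open>b\<^sup>2\<close>, and \<open>\<gamma>\<close> has to be strictly increasing even when \<open>S ** B ** K\<close> vanishes.\<close>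
  obtain b where b: "0 < b" "\<And>e. norm ((S ** B ** K) *v e) \<le> norm e * b"
    using bounded_linear.pos_bounded[OF matrix_vector_mul_bounded_linear[of "S ** B ** K"]] by blast
  have decay: "2 * ((S *v x) \<bullet> closed_loop A B K \<Phi> x e)
      \<le> - c * (norm x)\<^sup>2 + 2 * b * norm x * norm e" for x e
  proof -
    have "closed_loop A B K \<Phi> x e = (A *v x + B *v ((K + \<Phi>) *v x)) + B *v (K *v e)"
      by (simp add: closed_loop_def matrix_vector_mult_add_rdistrib
          matrix_vector_right_distrib matrix_vector_mul_assoc)
    then have split: "2 * ((S *v x) \<bullet> closed_loop A B K \<Phi> x e)
        = - (x \<bullet> ((?G + Q + ?U) *v x)) + 2 * ((S *v x) \<bullet> (B *v (K *v e)))"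
      unfolding riccati_decay_matched[OF S R riccati K, symmetric]
      by (simp add: inner_add_right)
    have "0 \<le> x \<bullet> (?G *v x)" using bound by (simp add: pos_semidef_def)
    moreover have "0 \<le> x \<bullet> (?U *v x)"
      unfolding inner_congruence using R
      by (cases "(K + \<Phi>) *v x = 0") (auto simp: pos_def_def less_imp_le)
    ultimately have nominal: "c * (norm x)\<^sup>2 \<le> x \<bullet> ((?G + Q + ?U) *v x)"
      using c(2)[of x]
      by (simp only: matrix_vector_mult_add_rdistrib[of _ ?U] matrix_vector_mult_add_rdistrib[of _ Q]
          inner_add_right)
    have "(S *v x) \<bullet> (B *v (K *v e)) = x \<bullet> ((S ** B ** K) *v e)"
      by (simp add: pos_def_sym[OF S] matrix_vector_mul_assoc matrix_mul_assoc)
    also have "\<dots> \<le> norm x * norm ((S ** B ** K) *v e)" by (rule norm_cauchy_schwarz)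
    also have "\<dots> \<le> norm x * (norm e * b)" by (intro mult_left_mono b) auto
    finally show ?thesis using nominal split by (simp add: mult_ac)
  qed
  show ?thesis by (rule quadratic_ISS[OF S c(1) _ decay]) (use b in simp)
qed

theorem theorem1:
  fixes A :: "real ^ 'l \<Rightarrow> real ^ 'n ^ 'n"
    and B :: "real ^ 'm ^ 'n"
    and \<phi> :: "real ^ 'l \<Rightarrow> real ^ 'n ^ 'm"
    and P :: "(real ^ 'l) set"
    and p0 p :: "real ^ 'l"
    and Q F S Q1 :: "real ^ 'n ^ 'n"
    and R :: "real ^ 'm ^ 'm"
    and K1 :: "real ^ 'n ^ 'm"
    and \<sigma> \<mu>1 :: real
    and x :: "real \<Rightarrow> real ^ 'n"
    and t :: "nat \<Rightarrow> ereal"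
  assumes matched: "\<forall>q\<in>P. A q - A p0 = B ** \<phi> q"
    and bounded_uncertainty: "bounded (\<phi> ` P)"
    and Q: "pos_def Q"
    and R: "pos_def R"
    and F: "pos_semidef F"
    and uncertainty_bound: "\<forall>q\<in>P. pos_semidef (F - transpose (\<phi> q) ** R ** \<phi> q)"
    and \<sigma>: "0 < \<sigma>" "\<sigma> < 1"
    and p: "p \<in> P"
    and S: "pos_def S"
    and riccati: "S ** A p0 + transpose (A p0) ** S + F + Q
                    - S ** B ** matrix_inv R ** transpose B ** S = 0"
    and K1: "K1 = - (matrix_inv R ** transpose B ** S)"
    and K1_optimal: "optimal_gain (A p0) B (F + Q) R K1"
    and SBK1: "S ** B ** K1 \<noteq> 0"
    and Q1: "Q1 = (F - transpose (\<phi> p) ** R ** \<phi> p) + Q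
                    + transpose (K1 + \<phi> p) ** R ** (K1 + \<phi> p)"
    and \<mu>1: "\<mu>1 = \<sigma> * lambda_min Q1 / (2 * induced_norm (S ** B ** K1))"
    and solution: "sampled_data_solution (A p) B K1 x t"
    and events: "event_instants \<mu>1 x t"
  shows "(\<forall>k. \<forall>s \<in> inter_event t k.
            (x has_vector_derivative
               closed_loop (A p0) B K1 (\<phi> p) (x s) (measurement_error x t k s))
              (at s within inter_event t k))
         \<and> input_to_state_stable (closed_loop (A p0) B K1 (\<phi> p))"
proof (intro conjI allI ballI)
  have match_p: "A p - A p0 = B ** \<phi> p" using matched p by blast
  fix k s
  assume "s \<in> inter_event t k"
  then show "(x has_vector_derivative
      closed_loop (A p0) B K1 (\<phi> p) (x s) (measurement_error x t k s)) (at s within inter_event t k)"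
    using solution
    unfolding sampled_data_solution_def measurement_error_def
      held_control_eq_closed_loop[OF match_p] by blast
next
  have "pos_semidef (F - transpose (\<phi> p) ** R ** \<phi> p)" using uncertainty_bound p by blast
  from matched_closed_loop_ISS[OF S R Q this riccati K1]
  show "input_to_state_stable (closed_loop (A p0) B K1 (\<phi> p))"
    unfolding input_to_state_stable_def by blast
qed

end
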